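(* Let $\rho\in\mathcal P(\mathbb R^d)$ satisfy $\lim_{r\to0}\mu_\rho(r)<\frac{1}{N(N-1)^2}$, and let $\beta>0$ be such that $\mu_\rho(\beta)<\frac{1}{N(N-1)^2}$. Let $u$ be a Kantorovich potential (for $\rho$ and the cost $c$) which satisfies $$u(x)=\inf\Big\{c(x,y_2,\dots,y_N)-\sum_{j=2}^N u(y_j)\ :\ y_2,\dots,y_N\in\mathbb R^d\Big\}\qquad\text{for all }x\in\mathbb R^d.$$ Then for every $\alpha>0$ with $\alpha<\phi^{-1}\big(\frac{N^2(N-1)}{2}\phi(\beta)\big)$ it holds $$\sup_{\mathbb R^d}|u|\le N(N-1)^2\,\phi\Big(\frac{\alpha}{2}\Big).$$
   Context: $d\ge1$ and $N>1$ are integers; $\mathcal P(X)$ is the set of Borel probability measures on $X$. The function $\phi:(0,+\infty)\to[0,+\infty)$ is continuous, strictly decreasing, and $\lim_{t\to0^+}\phi(t)=+\infty$; by convention $\phi(0)=+\infty$. The cost is $c(x_1,\dots,x_N)=\sum_{1\le i<j\le N}\phi(|x_i-x_j|)$ for $x_1,\dots,x_N\in\mathbb R^d$. Measure of concentration: $\mu_\rho(r)=\sup_{x\in\mathbb R^d}\rho(B(x,r))$, with $B(x,r)$ the open ball. A Kantorovich potential is a maximizer of $N\int u\,d\rho$ among the $\rho$-integrable functions $u:\mathbb R^d\to\mathbb R$ satisfying $u(x_1)+\dots+u(x_N)\le c(x_1,\dots,x_N)$ for all $x_1,\dots,x_N\in\mathbb R^d$. *)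

theory Defs
  imports "HOL-Probability.Probability"
begin

text \<open>Convention \<open>\<phi>(0) = +\<infinity>\<close>; here \<open>\<phi>\<close> is only meaningful on \<open>{0<..}\<close>.\<close>

definition phi_ext :: "(real \<Rightarrow> real) \<Rightarrow> real \<Rightarrow> ereal" where
  "phi_ext \<phi> t = (if t = 0 then \<infinity> else ereal (\<phi> t))"

text \<open>An \<open>N\<close>-tuple is a function on \<open>nat\<close> of which only the values at \<open>1, \<dots>, N\<close> matter.\<close>

definition cost :: "(real \<Rightarrow> real) \<Rightarrow> nat \<Rightarrow> (nat \<Rightarrow> real ^ 'd) \<Rightarrow> ereal" where
  "cost \<phi> N x = (\<Sum>i\<in>{1..N}. \<Sum>j\<in>{i<..N}. phi_ext \<phi> (norm (x i - x j)))"

definition concentration :: "(real ^ 'd) measure \<Rightarrow> real \<Rightarrow> real" where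
  "concentration \<rho> r = (SUP x. measure \<rho> (ball x r))"

definition kantorovich_admissible ::
  "(real ^ 'd) measure \<Rightarrow> (real \<Rightarrow> real) \<Rightarrow> nat \<Rightarrow> (real ^ 'd \<Rightarrow> real) \<Rightarrow> bool" where
  "kantorovich_admissible \<rho> \<phi> N u \<longleftrightarrow>
     integrable \<rho> u \<and> (\<forall>x. ereal (\<Sum>i\<in>{1..N}. u (x i)) \<le> cost \<phi> N x)"

definition kantorovich_potential ::
  "(real ^ 'd) measure \<Rightarrow> (real \<Rightarrow> real) \<Rightarrow> nat \<Rightarrow> (real ^ 'd \<Rightarrow> real) \<Rightarrow> bool" where
  "kantorovich_potential \<rho> \<phi> N u \<longleftrightarrow>
     kantorovich_admissible \<rho> \<phi> N u \<and>
     (\<forall>v. kantorovich_admissible \<rho> \<phi> N v \<longrightarrow>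
        real N * (\<integral>x. v x \<partial>\<rho>) \<le> real N * (\<integral>x. u x \<partial>\<rho>))"

end

theory Submission imports Defs begin

text \<open>
  No transport plan is needed: both optimality and the bound are exploited on the dual side.
  If \<open>A\<^sub>1, \<dots>, A\<^sub>N\<close> satisfy \<open>\<Sum>\<rho>(A\<^sub>j) < 1\<close>, then there are points \<open>x\<^sub>j \<notin> A\<^sub>j\<close> with
  \<open>\<Sum>u(x\<^sub>j)\<close> almost nonnegative, since otherwise \<open>u + (\<epsilon>/N)(1 - \<Sum>1\<^bsub>A\<^sub>j\<^esub>)\<close> would be
  an admissible function with larger integral.  Given \<open>x\<close>, start from the tuple \<open>(x, \<dots>, x)\<close> and
  choose successively \<open>N - 1\<close> such tuples, the \<open>i\<close>-th point of each one avoiding the \<open>\<beta>\<close>-balls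
  around the \<open>i\<close>-th points of the previous ones.  In the resulting \<open>N \<times> N\<close> array the total of
  \<open>u\<close> is at least \<open>N u(x)\<close> up to \<open>\<epsilon>\<close> when summed by tuples, and at most \<open>N\<^sup>2(N-1) \<phi>(\<beta>)\<close> when
  summed over the transposed, \<open>\<beta>\<close>-separated, tuples.  So \<open>u \<le> N(N-1) \<phi>(\<beta>)\<close>, the
  conjugacy relation turns this into a lower bound, and \<open>\<phi>(\<beta>) \<le> \<phi>(\<alpha>/2)\<close>.
\<close>

section \<open>Permutations avoiding few forbidden pairs\<close>

text \<open>The \<open>N\<close> cyclic shifts of \<open>{1..N}\<close> have pairwise disjoint
  graphs, so fewer than \<open>N\<close> forbidden pairs cannot meet all of them.\<close>

lemma exists_avoiding_permutation:
  fixes P :: "nat \<Rightarrow> nat \<Rightarrow> bool"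
  assumes "card {(i, j). i \<in> {1..N} \<and> j \<in> {1..N} \<and> P i j} < N"
  obtains \<sigma> where "bij_betw \<sigma> {1..N} {1..N}" "\<And>j. j \<in> {1..N} \<Longrightarrow> \<not> P (\<sigma> j) j"
proof -
  have N: "N > 0" using assms by simp
  \<comment> \<open>The offset \<open>c\<close> lets one fact serve two index windows: positions in
    \<open>{1..N}\<close> (\<open>c = 1\<close>) and shifts in \<open>{..<N}\<close>
    (\<open>c = 0\<close>).\<close>
  have mod_inj: "a = b" if "(k + a) mod N = (k + b) mod N" "a < N + c" "b < N + c" "c \<le> a" "c \<le> b"
    for a b c k :: nat
  proof -
    have *: "a = b" if "(k + a) mod N = (k + b) mod N" "a \<le> b" "b < N + c" "c \<le> a" for a b
    proof -
      have "N dvd (k + b) - (k + a)"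
        using that by (subst mod_eq_dvd_iff_nat[symmetric]) auto
      then have "N dvd b - a" by simp
      moreover have "b - a < N" using that by linarith
      ultimately show "a = b" using \<open>a \<le> b\<close> by (auto dest: nat_dvd_not_less)
    qed
    show ?thesis
      using *[of a b] *[of b a] that by (metis nat_le_linear)
  qed
  define \<tau> where "\<tau> s j = (s + j) mod N + 1" for s j
  have range: "\<tau> s j \<in> {1..N}" for s j
    using N by (auto simp: \<tau>_def Suc_le_eq)
  have bij: "bij_betw (\<tau> s) {1..N} {1..N}" for s
  proof -
    have "inj_on (\<tau> s) {1..N}"
      by (rule inj_onI, rule mod_inj[of s _ _ 1]) (auto simp: \<tau>_def)
    moreover have "\<tau> s ` {1..N} \<subseteq> {1..N}" using range by blast
    ultimately show ?thesis
      by (simp add: bij_betw_def endo_inj_surj)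
  qed
  have "\<exists>s<N. \<forall>j\<in>{1..N}. \<not> P (\<tau> s j) j"
  proof (rule ccontr)
    assume "\<not> ?thesis"
    then obtain f where f: "\<And>s. s < N \<Longrightarrow> f s \<in> {1..N} \<and> P (\<tau> s (f s)) (f s)"
      by metis
    let ?h = "\<lambda>s. (\<tau> s (f s), f s)"
    \<comment> \<open>A pair \<open>(\<tau> s j, j)\<close> determines the shift \<open>s\<close>,
      so the \<open>N\<close> shifts would produce \<open>N\<close> distinct forbidden
      pairs.\<close>
    have "inj_on ?h {..<N}"
    proof (rule inj_onI)
      fix s s' assume "s \<in> {..<N}" "s' \<in> {..<N}" "?h s = ?h s'"
      then show "s = s'"
        using mod_inj[of "f s" s s' 0] by (auto simp: \<tau>_def add.commute)
    qed
    moreover have "?h ` {..<N} \<subseteq> {(i, j). i \<in> {1..N} \<and> j \<in> {1..N} \<and> P i j}"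
      using f range by auto
    moreover have "finite {(i, j). i \<in> {1..N} \<and> j \<in> {1..N} \<and> P i j}"
      by (rule finite_subset[of _ "{1..N} \<times> {1..N}"]) auto
    ultimately have "N \<le> card {(i, j). i \<in> {1..N} \<and> j \<in> {1..N} \<and> P i j}"
      using card_inj_on_le[of ?h "{..<N}"] by simp
    with assms show False by simp
  qed
  then show thesis using bij that by blast
qed

section \<open>Bounds on the cost\<close>

lemma cost_nonneg:
  assumes "\<And>t. t > 0 \<Longrightarrow> \<phi> t \<ge> 0"
  shows "0 \<le> cost \<phi> N x"
  unfolding cost_def phi_ext_def by (intro sum_nonneg) (auto intro: assms)

lemma cost_le_separated:
  assumes anti: "strict_antimono_on {0<..} \<phi>"
    and nonneg: "\<And>t. t > 0 \<Longrightarrow> \<phi> t \<ge> 0"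
    and "\<beta> > 0"
    and sep: "\<And>i j. 1 \<le> i \<Longrightarrow> i < j \<Longrightarrow> j \<le> N \<Longrightarrow> \<beta> \<le> norm (x i - x j)"
  shows "cost \<phi> N x \<le> ereal (real N * (real N - 1) * \<phi> \<beta>)"
proof -
  have "phi_ext \<phi> (norm (x i - x j)) \<le> ereal (\<phi> \<beta>)" if "1 \<le> i" "i < j" "j \<le> N" for i j
  proof -
    let ?t = "norm (x i - x j)"
    have t: "\<beta> \<le> ?t" using sep that by blast
    then have "\<phi> ?t \<le> \<phi> \<beta>"
      using monotone_onD[OF anti, of \<beta> ?t] \<open>\<beta> > 0\<close> by (cases "\<beta> = ?t") force+
    with t \<open>\<beta> > 0\<close> show ?thesis by (auto simp: phi_ext_def)
  qed
  then have "cost \<phi> N x \<le> (\<Sum>i\<in>{1..N}. \<Sum>j\<in>{i<..N}. ereal (\<phi> \<beta>))"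
    unfolding cost_def by (intro sum_mono) auto
  also have "\<dots> = ereal (\<Sum>i\<in>{1..N}. real (N - i) * \<phi> \<beta>)"
    by simp
  \<comment> \<open>Replacing \<open>N - i\<close> by \<open>N - 1\<close> gives up a factor of two
    compared with the exact number of pairs; the cruder constant suffices for the final
    bound.\<close>
  also have "\<dots> \<le> ereal (\<Sum>i\<in>{1..N}. (real N - 1) * \<phi> \<beta>)"
    unfolding ereal_less_eq
    by (intro sum_mono mult_right_mono) (auto simp: of_nat_diff intro: nonneg \<open>\<beta> > 0\<close>)
  finally show ?thesis by (simp add: mult.assoc)
qed

section \<open>Consequences of optimality of the potential\<close>

lemma potential_avoiding_tuple:
  fixes \<rho> :: "(real ^ 'd) measure"
  assumes "N > 0"
    and nonneg: "\<And>t. t > 0 \<Longrightarrow> \<phi> t \<ge> 0"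
    and prob: "prob_space \<rho>"
    and pot: "kantorovich_potential \<rho> \<phi> N u"
    and A: "\<And>j. j \<in> {1..N} \<Longrightarrow> A j \<in> sets \<rho>"
    and small: "(\<Sum>j\<in>{1..N}. measure \<rho> (A j)) < 1"
    and "\<epsilon> > 0"
  obtains x where "\<And>j. j \<in> {1..N} \<Longrightarrow> x j \<notin> A j" "(\<Sum>j\<in>{1..N}. u (x j)) > - \<epsilon>"
proof (rule ccontr)
  interpret prob_space \<rho> by fact
  assume "\<not> thesis"
  note no_tuple = this and witness = that
  have low: "(\<Sum>j\<in>{1..N}. u (x j)) \<le> - \<epsilon>" if "\<And>j. j \<in> {1..N} \<Longrightarrow> x j \<notin> A j" for x
    using that no_tuple witness[of x] by fastforce
  have adm: "integrable \<rho> u" "\<And>x. ereal (\<Sum>i\<in>{1..N}. u (x i)) \<le> cost \<phi> N x"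
    and max: "\<And>v. kantorovich_admissible \<rho> \<phi> N v \<Longrightarrow>
        real N * (\<integral>x. v x \<partial>\<rho>) \<le> real N * (\<integral>x. u x \<partial>\<rho>)"
    using pot by (auto simp: kantorovich_potential_def kantorovich_admissible_def)
  \<comment> \<open>The weight \<open>\<epsilon> / N\<close> limits the total gain over a tuple to
    \<epsilon>, while the mean of the perturbation stays positive because the measures of the
    \<open>A j\<close> sum to less than 1.\<close>
  define v where
    "v x = u x + \<epsilon> / real N * (1 - (\<Sum>j\<in>{1..N}. indicat_real (A j) x))" for x
  have int_ind: "integrable \<rho> (\<lambda>x. \<Sum>j\<in>{1..N}. indicat_real (A j) x)"
    using A by (intro Bochner_Integration.integrable_sum integrable_real_indicator)
      (auto simp: less_top[symmetric])
  have int_v: "integrable \<rho> v"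
    unfolding v_def using adm(1) int_ind by auto
  have "(\<integral>x. v x \<partial>\<rho>) = (\<integral>x. u x \<partial>\<rho>) + \<epsilon> / real N * (1 - (\<Sum>j\<in>{1..N}. measure \<rho> (A j)))"
  proof -
    have "(\<integral>x. (\<Sum>j\<in>{1..N}. indicat_real (A j) x) \<partial>\<rho>) = (\<Sum>j\<in>{1..N}. measure \<rho> (A j))"
      using A by (subst Bochner_Integration.integral_sum)
        (auto simp: less_top[symmetric] intro!: sum.cong integrable_real_indicator)
    then show ?thesis
      unfolding v_def using adm(1) int_ind by (simp add: prob_space)
  qed
  moreover have "\<epsilon> / real N * (1 - (\<Sum>j\<in>{1..N}. measure \<rho> (A j))) > 0"
    using small \<open>\<epsilon> > 0\<close> \<open>N > 0\<close> by simp
  ultimately have "real N * (\<integral>x. u x \<partial>\<rho>) < real N * (\<integral>x. v x \<partial>\<rho>)"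
    using \<open>N > 0\<close> by simp
  moreover have "ereal (\<Sum>i\<in>{1..N}. v (x i)) \<le> cost \<phi> N x" for x
  proof -
    \<comment> \<open>Admissibility of \<open>v\<close> depends on the number of incidences
      \<open>x i \<in> A j\<close>: the perturbation adds exactly
      \<open>\<epsilon> / N * (N - card ?P)\<close>.\<close>
    let ?P = "{(i, j). i \<in> {1..N} \<and> j \<in> {1..N} \<and> x i \<in> A j}"
    have "(\<Sum>i\<in>{1..N}. \<Sum>j\<in>{1..N}. indicat_real (A j) (x i))
        = (\<Sum>p\<in>{1..N} \<times> {1..N}. of_bool (p \<in> ?P))"
      unfolding sum.cartesian_product by (rule sum.cong) (auto simp: indicator_def)
    also have "\<dots> = real (card ?P)"
      by (subst sum_of_bool_eq) (auto intro!: arg_cong[where f = card])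
    finally have count: "(\<Sum>i\<in>{1..N}. \<Sum>j\<in>{1..N}. indicat_real (A j) (x i)) = real (card ?P)" .
    have "(\<Sum>i\<in>{1..N}. v (x i)) = (\<Sum>i\<in>{1..N}. u (x i)) + \<epsilon> / real N *
        (real N - (\<Sum>i\<in>{1..N}. \<Sum>j\<in>{1..N}. indicat_real (A j) (x i)))"
      unfolding v_def sum.distrib sum_distrib_left[symmetric] sum_subtractf by simp
    then have eq: "(\<Sum>i\<in>{1..N}. v (x i)) =
        (\<Sum>i\<in>{1..N}. u (x i)) + \<epsilon> / real N * (real N - real (card ?P))"
      unfolding count .
    show ?thesis
    proof (cases "card ?P < N")
      \<comment> \<open>The sum of \<open>u\<close> is invariant under permuting the points, and
        some permuted tuple avoids every \<open>A j\<close>. Its deficit \<epsilon> absorbs the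
        gain, leaving a sum at most 0, hence below the cost.\<close>
      case True
      then obtain \<sigma> where \<sigma>: "bij_betw \<sigma> {1..N} {1..N}" "\<And>j. j \<in> {1..N} \<Longrightarrow> x (\<sigma> j) \<notin> A j"
        using exists_avoiding_permutation[where P = "\<lambda>i j. x i \<in> A j"] by blast
      have "(\<Sum>i\<in>{1..N}. u (x i)) = (\<Sum>j\<in>{1..N}. u (x (\<sigma> j)))"
        using sum.reindex_bij_betw[OF \<sigma>(1), of "\<lambda>i. u (x i)"] by simp
      also have "\<dots> \<le> - \<epsilon>" using low[of "\<lambda>j. x (\<sigma> j)"] \<sigma>(2) by blast
      finally have "(\<Sum>i\<in>{1..N}. u (x i)) \<le> - \<epsilon>" .
      moreover have "\<epsilon> / real N * (real N - real (card ?P)) \<le> \<epsilon> / real N * real N"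
        using \<open>\<epsilon> > 0\<close> by (intro mult_left_mono) auto
      ultimately have "(\<Sum>i\<in>{1..N}. v (x i)) \<le> 0"
        unfolding eq using \<open>N > 0\<close> by simp
      then have "ereal (\<Sum>i\<in>{1..N}. v (x i)) \<le> 0" by (metis ereal_less_eq(3) zero_ereal_def)
      also have "0 \<le> cost \<phi> N x" by (rule cost_nonneg) (rule nonneg)
      finally show ?thesis .
    next
      \<comment> \<open>With at least \<open>N\<close> incidences the perturbation does not increase
        the sum, so admissibility of \<open>u\<close> carries over.\<close>
      case False
      then have "\<epsilon> / real N * (real N - real (card ?P)) \<le> 0"
        using \<open>\<epsilon> > 0\<close> by (intro mult_nonneg_nonpos) auto
      then have "ereal (\<Sum>i\<in>{1..N}. v (x i)) \<le> ereal (\<Sum>i\<in>{1..N}. u (x i))"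
        unfolding eq by simp
      then show ?thesis using adm(2) order_trans by blast
    qed
  qed
  ultimately show False
    using max[of v] int_v by (simp add: kantorovich_admissible_def)
qed

lemma measure_ball_le_concentration:
  assumes "prob_space \<rho>"
  shows "measure \<rho> (ball x r) \<le> concentration \<rho> r"
proof -
  interpret prob_space \<rho> by fact
  show ?thesis
    unfolding concentration_def by (rule cSUP_upper) (auto intro!: bdd_aboveI2 prob_le_1)
qed

text \<open>Row \<open>k\<close> of the array is the tuple \<open>X k\<close>. Separation is
  required down each column only, so a new row has to avoid, in column \<open>i\<close>, the balls
  around the earlier entries of that column; \<open>conc\<close> bounds the total measure of these
  balls over all columns.\<close>

lemma separated_array:
  fixes \<rho> :: "(real ^ 'd) measure"
  assumes "N > 0"
    and nonneg: "\<And>t. t > 0 \<Longrightarrow> \<phi> t \<ge> 0"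
    and prob: "prob_space \<rho>"
    and borel: "sets \<rho> = sets borel"
    and pot: "kantorovich_potential \<rho> \<phi> N u"
    and conc: "real N * (real m * concentration \<rho> \<beta>) < 1"
    and "\<epsilon> > 0"
  shows "\<exists>X. (\<forall>i. X 0 i = x) \<and>
    (\<forall>k\<in>{1..m}. (\<Sum>i\<in>{1..N}. u (X k i)) > - \<epsilon>) \<and>
    (\<forall>k\<le>m. \<forall>l<k. \<forall>i\<in>{1..N}. \<beta> \<le> dist (X l i) (X k i))"
  using conc
proof (induction m)
  case 0
  show ?case by (rule exI[of _ "\<lambda>_ _. x"]) auto
next
  case (Suc m)
  interpret prob_space \<rho> by fact
  have pos: "0 \<le> concentration \<rho> \<beta>"
    using measure_ball_le_concentration[OF prob, of x \<beta>] measure_nonneg order_trans by blast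
  have "real N * (real m * concentration \<rho> \<beta>) \<le> real N * (real (Suc m) * concentration \<rho> \<beta>)"
    using pos by (intro mult_left_mono mult_right_mono) auto
  with Suc obtain X where X: "\<And>i. X 0 i = x"
    "\<And>k. k \<in> {1..m} \<Longrightarrow> (\<Sum>i\<in>{1..N}. u (X k i)) > - \<epsilon>"
    "\<And>k l i. k \<le> m \<Longrightarrow> l < k \<Longrightarrow> i \<in> {1..N} \<Longrightarrow> \<beta> \<le> dist (X l i) (X k i)"
    by (metis le_less_trans)
  \<comment> \<open>Rows \<open>0\<close> to \<open>m\<close> are all avoided, row \<open>0\<close>
    included: \<open>Suc m\<close> balls per column, matching the factor in the induction
    premise.\<close>
  define A where "A i = (\<Union>l\<in>{..m}. ball (X l i) \<beta>)" for i
  have "measure \<rho> (A i) \<le> real (Suc m) * concentration \<rho> \<beta>" for i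
  proof -
    have "measure \<rho> (A i) \<le> (\<Sum>l\<in>{..m}. measure \<rho> (ball (X l i) \<beta>))"
      unfolding A_def by (rule finite_measure_subadditive_finite) (auto simp: borel)
    also have "\<dots> \<le> (\<Sum>l\<in>{..m}. concentration \<rho> \<beta>)"
      by (intro sum_mono measure_ball_le_concentration prob)
    finally show ?thesis by simp
  qed
  then have "(\<Sum>i\<in>{1..N}. measure \<rho> (A i)) \<le> (\<Sum>i\<in>{1..N}. real (Suc m) * concentration \<rho> \<beta>)"
    by (intro sum_mono)
  also have "\<dots> < 1" using Suc.prems by simp
  finally have "(\<Sum>i\<in>{1..N}. measure \<rho> (A i)) < 1" .
  moreover have "A i \<in> sets \<rho>" for i
    unfolding A_def borel by auto
  ultimately obtain z where z: "\<And>i. i \<in> {1..N} \<Longrightarrow> z i \<notin> A i" "(\<Sum>i\<in>{1..N}. u (z i)) > - \<epsilon>"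
    using potential_avoiding_tuple[OF \<open>N > 0\<close> nonneg prob pot _ _ \<open>\<epsilon> > 0\<close>, of A] by blast
  have "\<beta> \<le> dist (X l i) (z i)" if "l \<le> m" "i \<in> {1..N}" for l i
    using z(1)[OF that(2)] that(1) by (force simp: A_def)
  then show ?case
    using X z(2) by (intro exI[of _ "X(Suc m := z)"]) (auto simp: le_Suc_eq)
qed

lemma potential_upper_bound:
  fixes \<rho> :: "(real ^ 'd) measure"
  assumes "N > 0"
    and nonneg: "\<And>t. t > 0 \<Longrightarrow> \<phi> t \<ge> 0"
    and anti: "strict_antimono_on {0<..} \<phi>"
    and prob: "prob_space \<rho>"
    and borel: "sets \<rho> = sets borel"
    and pot: "kantorovich_potential \<rho> \<phi> N u"
    and "\<beta> > 0"
    and conc: "real N * ((real N - 1) * concentration \<rho> \<beta>) < 1"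
  shows "u x \<le> real N * (real N - 1) * \<phi> \<beta>"
proof (rule field_le_epsilon)
  fix \<epsilon> :: real assume "\<epsilon> > 0"
  let ?M = "real N * (real N - 1) * \<phi> \<beta>"
  have conc': "real N * (real (N - 1) * concentration \<rho> \<beta>) < 1"
    using conc \<open>N > 0\<close> by (simp add: of_nat_diff)
  obtain X where X: "\<And>i. X 0 i = x"
    "\<And>k. k \<in> {1..N - 1} \<Longrightarrow> (\<Sum>i\<in>{1..N}. u (X k i)) > - \<epsilon>"
    "\<And>k l i. k \<le> N - 1 \<Longrightarrow> l < k \<Longrightarrow> i \<in> {1..N} \<Longrightarrow> \<beta> \<le> dist (X l i) (X k i)"
    using separated_array[OF \<open>N > 0\<close> nonneg prob borel pot conc' \<open>\<epsilon> > 0\<close>, of x] by metis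
  \<comment> \<open>Rows are numbered from 0 and cost arguments from 1, hence the shift
    \<open>k - 1\<close>.\<close>
  have col: "(\<Sum>k\<in>{1..N}. u (X (k - 1) i)) \<le> ?M" if i: "i \<in> {1..N}" for i
  proof -
    have "ereal (\<Sum>k\<in>{1..N}. u (X (k - 1) i)) \<le> cost \<phi> N (\<lambda>k. X (k - 1) i)"
      using pot by (auto simp: kantorovich_potential_def kantorovich_admissible_def)
    also have "\<dots> \<le> ereal ?M"
    proof (rule cost_le_separated[OF anti nonneg \<open>\<beta> > 0\<close>])
      fix k l :: nat assume "1 \<le> k" "k < l" "l \<le> N"
      then have "\<beta> \<le> dist (X (k - 1) i) (X (l - 1) i)" by (intro X(3) i) auto
      then show "\<beta> \<le> norm (X (k - 1) i - X (l - 1) i)" by (simp add: dist_norm)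
    qed
    finally show ?thesis by simp
  qed
  \<comment> \<open>Only the \<open>N - 1\<close> chosen rows lose \<epsilon>; allowing a loss of
    \<open>N * \<epsilon>\<close> makes the final inequality divisible by \<open>N\<close>.\<close>
  have "real N * u x - real N * \<epsilon> \<le> real N * u x - real (N - 1) * \<epsilon>"
    using \<open>\<epsilon> > 0\<close> by (simp add: mult_right_mono)
  also have "\<dots> = (\<Sum>i\<in>{1..N}. u (X 0 i)) + (\<Sum>k\<in>{1..N - 1}. - \<epsilon>)"
    by (simp add: X(1))
  also have "\<dots> \<le> (\<Sum>i\<in>{1..N}. u (X 0 i)) + (\<Sum>k\<in>{1..N - 1}. \<Sum>i\<in>{1..N}. u (X k i))"
    by (intro add_left_mono sum_mono less_imp_le X(2))
  also have "\<dots> = (\<Sum>k\<in>{0..N - 1}. \<Sum>i\<in>{1..N}. u (X k i))"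
    by (simp add: sum.atLeast_Suc_atMost)
  also have "\<dots> = (\<Sum>k\<in>{1..N}. \<Sum>i\<in>{1..N}. u (X (k - 1) i))"
    by (rule sum.reindex_bij_witness[of _ "\<lambda>k. k - 1" Suc]) (use \<open>N > 0\<close> in auto)
  also have "\<dots> = (\<Sum>i\<in>{1..N}. \<Sum>k\<in>{1..N}. u (X (k - 1) i))"
    by (rule sum.swap)
  also have "\<dots> \<le> (\<Sum>i\<in>{1..N}. ?M)"
    by (intro sum_mono col)
  also have "\<dots> = real N * ?M" by simp
  finally have "real N * u x \<le> real N * (?M + \<epsilon>)" unfolding distrib_left by linarith
  then show "u x \<le> ?M + \<epsilon>" using \<open>N > 0\<close> by simp
qed

section \<open>The range of \<phi>\<close>

text \<open>Since \<phi> blows up at 0, it exceeds \<open>y\<close> somewhere left of \<beta>, and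
  the intermediate value theorem applies. This makes \<open>inv_into\<close> a genuine inverse at
  \<open>y\<close>.\<close>

lemma surj_above_value:
  fixes \<phi> :: "real \<Rightarrow> real"
  assumes cont: "continuous_on {0<..} \<phi>"
    and lim: "filterlim \<phi> at_top (at_right 0)"
    and "\<beta> > 0" "\<phi> \<beta> \<le> y"
  shows "y \<in> \<phi> ` {0<..}"
proof -
  have "\<forall>\<^sub>F s in at_right 0. y \<le> \<phi> s"
    using lim by (simp add: filterlim_at_top)
  moreover have "\<forall>\<^sub>F s in at_right 0. s \<in> {0<..<\<beta>}"
    using \<open>\<beta> > 0\<close> by (rule eventually_at_right_real)
  ultimately have "\<forall>\<^sub>F s in at_right 0. y \<le> \<phi> s \<and> s \<in> {0<..<\<beta>}"
    by (rule eventually_conj)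
  then obtain s where s: "y \<le> \<phi> s" "0 < s" "s < \<beta>"
    using eventually_happens[of _ "at_right (0::real)"] by (auto simp: trivial_limit_at_right_real)
  then have "\<exists>t. s \<le> t \<and> t \<le> \<beta> \<and> \<phi> t = y"
    using \<open>\<phi> \<beta> \<le> y\<close> by (intro IVT2' continuous_on_subset[OF cont]) auto
  with s show ?thesis by force
qed

section \<open>The two-sided bound\<close>

theorem theorem3p4:
  fixes \<rho> :: "(real ^ 'd) measure"
    and \<phi> :: "real \<Rightarrow> real"
    and N :: nat
    and u :: "real ^ 'd \<Rightarrow> real"
    and \<alpha> \<beta> :: real
  assumes "N > 1"
    and "\<And>t. t > 0 \<Longrightarrow> \<phi> t \<ge> 0"
    and "continuous_on {0<..} \<phi>"
    and "strict_antimono_on {0<..} \<phi>"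
    and "filterlim \<phi> at_top (at_right 0)"
    and "prob_space \<rho>"
    and "sets \<rho> = sets borel"
    and "Lim (at_right 0) (concentration \<rho>) < 1 / (real N * (real N - 1)\<^sup>2)"
    and "\<beta> > 0"
    and "concentration \<rho> \<beta> < 1 / (real N * (real N - 1)\<^sup>2)"
    and "kantorovich_potential \<rho> \<phi> N u"
    and "\<And>x. ereal (u x) =
           Inf {cost \<phi> N y - ereal (\<Sum>j\<in>{2..N}. u (y j)) | y. y 1 = x}"
    and "\<alpha> > 0"
    and "\<alpha> < inv_into {0<..} \<phi> ((real N)\<^sup>2 * (real N - 1) / 2 * \<phi> \<beta>)"
  shows "(SUP x. ereal \<bar>u x\<bar>) \<le> ereal (real N * (real N - 1)\<^sup>2 * \<phi> (\<alpha> / 2))"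
proof -
  note nonneg = assms(2) and anti = assms(4) and conj = assms(12)
  have N: "real N \<ge> 2" using \<open>N > 1\<close> by simp
  let ?K = "(real N)\<^sup>2 * (real N - 1) / 2"
  let ?M = "real N * (real N - 1) * \<phi> \<beta>"
  have M: "0 \<le> ?M" using N nonneg[OF \<open>\<beta> > 0\<close>] by simp
  \<comment> \<open>Multiplying the concentration threshold by \<open>N * (N - 1)\<close> leaves
    \<open>1 / (N - 1)\<close>, which is at most 1.\<close>
  have "real N * ((real N - 1) * concentration \<rho> \<beta>) < 1"
  proof -
    have "real N * (real N - 1) * concentration \<rho> \<beta>
        < real N * (real N - 1) * (1 / (real N * (real N - 1)\<^sup>2))"
      using N assms(10) by (intro mult_strict_left_mono) auto
    also have "\<dots> = 1 / (real N - 1)" using N by (simp add: power2_eq_square)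
    also have "\<dots> \<le> 1" using N by simp
    finally show ?thesis by (simp add: mult.assoc)
  qed
  then have upper: "u x \<le> ?M" for x
    using \<open>N > 1\<close> assms(6,7,9,11) nonneg anti by (intro potential_upper_bound) auto
  \<comment> \<open>In the conjugacy formula the cost is nonnegative and each of the
    \<open>N - 1\<close> subtracted values is at most \<open>?M\<close>.\<close>
  have lower: "- ((real N - 1) * ?M) \<le> u x" for x
  proof -
    have "ereal (- ((real N - 1) * ?M)) \<le>
        Inf {cost \<phi> N y - ereal (\<Sum>j\<in>{2..N}. u (y j)) | y. y 1 = x}"
    proof (rule Inf_greatest)
      fix z assume "z \<in> {cost \<phi> N y - ereal (\<Sum>j\<in>{2..N}. u (y j)) | y. y 1 = x}"
      then obtain y where z: "z = cost \<phi> N y - ereal (\<Sum>j\<in>{2..N}. u (y j))" by blast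
      have "(\<Sum>j\<in>{2..N}. u (y j)) \<le> (\<Sum>j\<in>{2..N}. ?M)"
        by (intro sum_mono upper)
      also have "\<dots> = (real N - 1) * ?M"
        using \<open>N > 1\<close> by (simp add: of_nat_diff)
      finally have "ereal (- ((real N - 1) * ?M)) \<le> 0 - ereal (\<Sum>j\<in>{2..N}. u (y j))"
        by simp
      also have "\<dots> \<le> z"
        unfolding z by (intro ereal_minus_mono cost_nonneg nonneg order_refl)
      finally show "ereal (- ((real N - 1) * ?M)) \<le> z" .
    qed
    then show ?thesis unfolding conj[symmetric] by simp
  qed
  \<comment> \<open>Let \<open>t\<close> be the inverse value at \<open>?K * \<phi> \<beta>\<close>.
    Then \<open>\<alpha> / 2 < \<alpha> < t\<close>, and
    \<open>\<phi> t = ?K * \<phi> \<beta>\<close> is at least \<open>\<phi> \<beta>\<close> because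
    \<open>?K\<close> is at least 1.\<close>
  have phi: "\<phi> \<beta> \<le> \<phi> (\<alpha> / 2)"
  proof -
    have "2\<^sup>2 * 1 \<le> (real N)\<^sup>2 * (real N - 1)"
      using N by (intro mult_mono power_mono) auto
    then have "1 \<le> ?K" by simp
    then have K: "\<phi> \<beta> \<le> ?K * \<phi> \<beta>"
      using mult_right_mono[of 1 ?K "\<phi> \<beta>"] nonneg[OF \<open>\<beta> > 0\<close>] by simp
    then have range: "?K * \<phi> \<beta> \<in> \<phi> ` {0<..}"
      using assms(3,5,9) by (intro surj_above_value)
    have "\<phi> \<beta> \<le> \<phi> (inv_into {0<..} \<phi> (?K * \<phi> \<beta>))"
      using K f_inv_into_f[OF range] by simp
    also have "\<dots> < \<phi> (\<alpha> / 2)"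
      using monotone_onD[OF anti] assms(13,14) by fastforce
    finally show ?thesis by simp
  qed
  have "\<bar>u x\<bar> \<le> real N * (real N - 1)\<^sup>2 * \<phi> (\<alpha> / 2)" for x
  proof -
    \<comment> \<open>As \<open>N - 1\<close> is at least 1, the lower bound has the larger modulus
      and controls both signs.\<close>
    have "1 * ?M \<le> (real N - 1) * ?M"
      using N M by (intro mult_right_mono) auto
    with upper[of x] lower[of x] have "\<bar>u x\<bar> \<le> (real N - 1) * ?M" by linarith
    also have "\<dots> = real N * (real N - 1)\<^sup>2 * \<phi> \<beta>" by (simp add: power2_eq_square)
    also have "\<dots> \<le> real N * (real N - 1)\<^sup>2 * \<phi> (\<alpha> / 2)"
      using phi by (intro mult_left_mono) auto
    finally show ?thesis .
  qed
  then show ?thesis by (intro SUP_least) simp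
qed

end
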